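(* Let $\mathbb{T}$ be a time scale, $a,b\in\mathbb{T}$ with $a<b$, $t\in(a,b]_{\mathbb{T}}$, and $0\le\alpha\le 1$. Let $w,f,g\in C([a,b]_{\mathbb{T}},\mathbb{R})$ be diamond-$\alpha$ integrable functions and let $K:[a,b]_{\mathbb{T}}\times[a,b]_{\mathbb{T}}\to[0,\infty)$ be a nonnegative kernel. Assume that all the integrals appearing below exist and are finite. Let $p,q>1$ with $\frac1p+\frac1q=1$ and assume that \[ \mathcal{I}_{K}^{\alpha}(|w|)(t)=1. \] Suppose that $m,M,n,N$ are constants such that \[ 0<m\leq|f(s)|\leq M<\infty,\qquad 0<n\leq|g(s)|\leq N<\infty \] for all $s\in[a,t]_{\mathbb{T}}$. Then \[ \Big[\mathcal{I}_{K}^{\alpha}(|w||f|^p)(t)\Big]^{1/p}\Big[\mathcal{I}_{K}^{\alpha}(|w||g|^q)(t)\Big]^{1/q} \leq\left(\kappa\!\left[\left(\frac{M}{m}\right)^p\left(\frac{N}{n}\right)^q\right]\right)^{\gamma}\mathcal{I}_{K}^{\alpha}(|w||f||g|)(t), \] where $\gamma=\max\{\frac1p,\frac1q\}$ and $\kappa(h)=\frac{(h+1)^2}{4h}$ for $h>0$.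
   Context: A time scale $\mathbb{T}$ is a nonempty closed subset of $\mathbb{R}$. For $a,b\in\mathbb{T}$, $[a,b]_{\mathbb{T}}=[a,b]\cap\mathbb{T}$ and $(a,b]_{\mathbb{T}}=(a,b]\cap\mathbb{T}$. For $0\le\alpha\le1$ and $h$ delta and nabla integrable on $[a,b]_{\mathbb{T}}$, the diamond-$\alpha$ integral is \[ \int_a^b h(s)\diamond_\alpha s=\alpha\int_a^b h(s)\,\Delta s+(1-\alpha)\int_a^b h(s)\,\nabla s, \] where $\int\cdot\,\Delta s$ and $\int\cdot\,\nabla s$ are the usual delta and nabla integrals of time scale calculus. For a nonnegative kernel $K:[a,b]_{\mathbb{T}}\times[a,b]_{\mathbb{T}}\to[0,\infty)$ and a suitable function $h:[a,b]_{\mathbb{T}}\to\mathbb{R}$, the kernel-type diamond-$\alpha$ integral operator is \[ \mathcal{I}_{K}^{\alpha}h(t)=\int_a^t K(t,s)h(s)\diamond_\alpha s, \] provided that the integral exists and is finite. An expression such as $|w||f|^p$ denotes the function $s\mapsto|w(s)||f(s)|^p$. The function $\kappa$ is the Kantorovich ratio. *)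

theory Defs
  imports "HOL-Analysis.Analysis"
begin

definition time_scale :: "real set \<Rightarrow> bool" where
  "time_scale T \<longleftrightarrow> closed T \<and> T \<noteq> {}"

text \<open>
  The delta and nabla integrals are taken in the Lebesgue sense of Guseinov and of Bohner and
  Peterson. The length \<open>d - c\<close>, assigned to the intervals \<open>[c,d)\<close> of \<open>T\<close> (delta) or \<open>(c,d]\<close>
  of \<open>T\<close> (nabla) with end points in \<open>T\<close>, is extended by Caratheodory's construction; a set
  without a countable cover by such intervals has infinite outer measure (\<open>Inf {} = \<infinity>\<close>).
  The parameter \<open>J\<close> is the kind of interval. Real intervals serve in the covers, since only
  subsets of \<open>T\<close> are covered.
\<close>

definition ts_outer_measure :: "(real \<Rightarrow> real \<Rightarrow> real set) \<Rightarrow> real set \<Rightarrow> real set \<Rightarrow> ennreal" where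
  "ts_outer_measure J T E =
     Inf {\<Sum>i. ennreal (d i - c i) | (c :: nat \<Rightarrow> real) d.
            (\<forall>i. c i \<in> T \<and> d i \<in> T \<and> c i \<le> d i) \<and> E \<subseteq> (\<Union>i. J (c i) (d i))}"

definition ts_measure :: "(real \<Rightarrow> real \<Rightarrow> real set) \<Rightarrow> real set \<Rightarrow> real measure" where
  "ts_measure J T =
     measure_of T (lambda_system T (Pow T) (ts_outer_measure J T)) (ts_outer_measure J T)"

definition delta_measure :: "real set \<Rightarrow> real measure" where
  "delta_measure = ts_measure (\<lambda>c d. {c..<d})"

definition nabla_measure :: "real set \<Rightarrow> real measure" where
  "nabla_measure = ts_measure (\<lambda>c d. {c<..d})"

text \<open>The integrals from \<open>a\<close> to \<open>b\<close> are meant for \<open>a \<le> b\<close>.\<close>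

definition delta_integrable :: "real set \<Rightarrow> real \<Rightarrow> real \<Rightarrow> (real \<Rightarrow> real) \<Rightarrow> bool" where
  "delta_integrable T a b h \<longleftrightarrow> set_integrable (delta_measure T) ({a..<b} \<inter> T) h"

definition nabla_integrable :: "real set \<Rightarrow> real \<Rightarrow> real \<Rightarrow> (real \<Rightarrow> real) \<Rightarrow> bool" where
  "nabla_integrable T a b h \<longleftrightarrow> set_integrable (nabla_measure T) ({a<..b} \<inter> T) h"

definition delta_integral :: "real set \<Rightarrow> real \<Rightarrow> real \<Rightarrow> (real \<Rightarrow> real) \<Rightarrow> real" where
  "delta_integral T a b h = set_lebesgue_integral (delta_measure T) ({a..<b} \<inter> T) h"

definition nabla_integral :: "real set \<Rightarrow> real \<Rightarrow> real \<Rightarrow> (real \<Rightarrow> real) \<Rightarrow> real" where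
  "nabla_integral T a b h = set_lebesgue_integral (nabla_measure T) ({a<..b} \<inter> T) h"

definition diamond_integrable :: "real set \<Rightarrow> real \<Rightarrow> real \<Rightarrow> (real \<Rightarrow> real) \<Rightarrow> bool" where
  "diamond_integrable T a b h \<longleftrightarrow> delta_integrable T a b h \<and> nabla_integrable T a b h"

definition diamond_integral :: "real set \<Rightarrow> real \<Rightarrow> real \<Rightarrow> real \<Rightarrow> (real \<Rightarrow> real) \<Rightarrow> real" where
  "diamond_integral T \<alpha> a b h = \<alpha> * delta_integral T a b h + (1 - \<alpha>) * nabla_integral T a b h"

definition kernel_integrable ::
    "real set \<Rightarrow> real \<Rightarrow> (real \<Rightarrow> real \<Rightarrow> real) \<Rightarrow> (real \<Rightarrow> real) \<Rightarrow> real \<Rightarrow> bool" where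
  "kernel_integrable T a K h t \<longleftrightarrow> diamond_integrable T a t (\<lambda>s. K t s * h s)"

definition kernel_operator ::
    "real set \<Rightarrow> real \<Rightarrow> real \<Rightarrow> (real \<Rightarrow> real \<Rightarrow> real) \<Rightarrow> (real \<Rightarrow> real) \<Rightarrow> real \<Rightarrow> real" where
  "kernel_operator T a \<alpha> K h t = diamond_integral T \<alpha> a t (\<lambda>s. K t s * h s)"

definition kantorovich_ratio :: "real \<Rightarrow> real" where
  "kantorovich_ratio h = (h + 1)\<^sup>2 / (4 * h)"

text \<open>
  The construction does give measures, for which \<open>[c,d)\<close> and \<open>(c,d]\<close>, respectively, in \<open>T\<close>
  are measurable with measure \<open>d - c\<close>.
\<close>

lemma ts_outer_measure_le:
  assumes "\<And>i::nat. c i \<in> T \<and> d i \<in> T \<and> c i \<le> d i" "E \<subseteq> (\<Union>i. J (c i) (d i))"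
  shows "ts_outer_measure J T E \<le> (\<Sum>i. ennreal (d i - c i))"
  unfolding ts_outer_measure_def by (rule Inf_lower) (use assms in blast)

lemma ts_outer_measure_close:
  assumes "ts_outer_measure J T E < x"
  obtains c d :: "nat \<Rightarrow> real" where "\<forall>i. c i \<in> T \<and> d i \<in> T \<and> c i \<le> d i" "E \<subseteq> (\<Union>i. J (c i) (d i))"
    "(\<Sum>i. ennreal (d i - c i)) < x"
  using assms unfolding ts_outer_measure_def Inf_less_iff by blast

lemma ts_outer_measure_subadditive:
  "ts_outer_measure J T (\<Union>n. A n) \<le> (\<Sum>n. ts_outer_measure J T (A n))"
proof (rule ennreal_le_epsilon)
  fix e :: real assume fin: "(\<Sum>n. ts_outer_measure J T (A n)) < top" and e: "0 < e"
  define P where "P n c d \<longleftrightarrow> (\<forall>i::nat. c i \<in> T \<and> d i \<in> T \<and> c i \<le> d i) \<and> A n \<subseteq> (\<Union>i. J (c i) (d i)) \<and>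
    (\<Sum>i. ennreal (d i - c i)) \<le> ts_outer_measure J T (A n) + ennreal (e * (1/2) ^ Suc n)" for n c d
  have "\<exists>c d. P n c d" for n
  proof -
    have "ts_outer_measure J T (A n) < top"
      using fin by (metis ennreal_suminf_lessD)
    then have "ts_outer_measure J T (A n) < ts_outer_measure J T (A n) + ennreal (e * (1/2) ^ Suc n)"
        using e by (auto simp: ennreal_add_left_cancel_less less_top simp del: ennreal_plus power_Suc)
    then obtain c d :: "nat \<Rightarrow> real" where "\<forall>i. c i \<in> T \<and> d i \<in> T \<and> c i \<le> d i" "A n \<subseteq> (\<Union>i. J (c i) (d i))"
      "(\<Sum>i. ennreal (d i - c i)) < ts_outer_measure J T (A n) + ennreal (e * (1/2) ^ Suc n)"
      by (rule ts_outer_measure_close)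
    then show ?thesis unfolding P_def by (blast intro: less_imp_le)
  qed
  then obtain c d where "\<And>n. P n (c n) (d n)" by metis
  then have cd: "\<And>n i. c n i \<in> T \<and> d n i \<in> T \<and> c n i \<le> d n i"
    "\<And>n. A n \<subseteq> (\<Union>i. J (c n i) (d n i))"
    "\<And>n. (\<Sum>i. ennreal (d n i - c n i)) \<le> ts_outer_measure J T (A n) + e * (1/2) ^ Suc n"
    by (simp_all add: P_def)
  define c' where "c' = (\<lambda>k. c (fst (prod_decode k)) (snd (prod_decode k)))"
  define d' where "d' = (\<lambda>k. d (fst (prod_decode k)) (snd (prod_decode k)))"
  have cov: "(\<Union>n. A n) \<subseteq> (\<Union>k. J (c' k) (d' k))"
  proof
    fix y assume "y \<in> (\<Union>n. A n)"
    then obtain n where "y \<in> A n" by blast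
    then obtain i where "y \<in> J (c n i) (d n i)" using cd(2) by blast
    then have "y \<in> J (c' (prod_encode (n, i))) (d' (prod_encode (n, i)))"
      by (simp add: c'_def d'_def)
    then show "y \<in> (\<Union>k. J (c' k) (d' k))" by blast
  qed
  have "ts_outer_measure J T (\<Union>n. A n) \<le> (\<Sum>k. ennreal (d' k - c' k))"
    using cd(1) cov by (intro ts_outer_measure_le) (auto simp: c'_def d'_def)
  also have "\<dots> = (\<Sum>n. \<Sum>i. ennreal (d n i - c n i))"
    using suminf_ennreal_2dimen[where f = "\<lambda>(n,i). ennreal (d n i - c n i)"]
    by (simp add: c'_def d'_def case_prod_unfold)
  also have "\<dots> \<le> (\<Sum>n. ts_outer_measure J T (A n) + e * (1/2) ^ Suc n)"
    using cd(3) by (intro suminf_le) auto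
  also have "\<dots> = (\<Sum>n. ts_outer_measure J T (A n)) + (\<Sum>n. ennreal e * ennreal ((1/2) ^ Suc n))"
    using e by (subst suminf_add) (auto simp: ennreal_mult simp del: power_Suc)
  also have "\<dots> = (\<Sum>n. ts_outer_measure J T (A n)) + e"
    unfolding ennreal_suminf_cmult
    by (subst suminf_ennreal_eq[OF zero_le_power power_half_series]) auto
  finally show "ts_outer_measure J T (\<Union>n. A n) \<le> (\<Sum>n. ts_outer_measure J T (A n)) + e" .
qed

lemma ts_outer_measure_space:
  assumes T: "T \<noteq> {}" and J: "\<And>c. J c c = {}"
  shows "outer_measure_space (Pow T) (ts_outer_measure J T)"
proof -
  let ?O = "ts_outer_measure J T"
  obtain x where x: "x \<in> T" using T by blast
  have "?O {} \<le> (\<Sum>i::nat. ennreal (x - x))"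
    using x by (intro ts_outer_measure_le) auto
  then have empty: "?O {} = 0" by simp
  have mono: "?O A \<le> ?O B" if "A \<subseteq> B" for A B
    unfolding ts_outer_measure_def by (rule Inf_superset_mono) (use that in blast)
  show ?thesis
    unfolding outer_measure_space_def positive_def increasing_def countably_subadditive_def
    using empty mono ts_outer_measure_subadditive by auto
qed

lemma measure_space_ts_measure:
  assumes "T \<noteq> {}" and "\<And>c. J c c = {}"
  shows "measure_space T (lambda_system T (Pow T) (ts_outer_measure J T)) (ts_outer_measure J T)"
  by (rule sigma_algebra.caratheodory_lemma[OF sigma_algebra_Pow ts_outer_measure_space[OF assms]])

lemma ts_measure_char:
  assumes "T \<noteq> {}" and "\<And>c. J c c = {}"
  shows space_ts_measure: "space (ts_measure J T) = T"
    and sets_ts_measure: "sets (ts_measure J T) = lambda_system T (Pow T) (ts_outer_measure J T)"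
    and emeasure_ts_measure: "A \<in> lambda_system T (Pow T) (ts_outer_measure J T) \<Longrightarrow>
           emeasure (ts_measure J T) A = ts_outer_measure J T A"
proof -
  let ?L = "lambda_system T (Pow T) (ts_outer_measure J T)"
  have ms: "measure_space T ?L (ts_outer_measure J T)"
    by (rule measure_space_ts_measure[OF assms])
  then interpret sigma_algebra T ?L by (simp add: measure_space_def)
  have P: "?L \<subseteq> Pow T" using space_closed .
  show "space (ts_measure J T) = T" by (simp add: ts_measure_def space_measure_of[OF P])
  show S: "sets (ts_measure J T) = ?L"
    by (simp add: ts_measure_def sets_measure_of[OF P] sigma_sets_eq)
  show "emeasure (ts_measure J T) A = ts_outer_measure J T A" if "A \<in> ?L"
    using ms that S by (intro emeasure_measure_of[OF ts_measure_def P])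
      (auto simp: measure_space_def sigma_sets_eq)
qed

lemma ts_outer_measure_interval:
  assumes T: "closed T" and cd: "c \<in> T" "d \<in> T" "c \<le> d"
  shows "ts_outer_measure (\<lambda>c d. {c..<d}) T ({c..<d} \<inter> T) = d - c"
    and "ts_outer_measure (\<lambda>c d. {c<..d}) T ({c<..d} \<inter> T) = d - c"
proof -
  have up: "ts_outer_measure J T (J c d \<inter> T) \<le> d - c" for J :: "real \<Rightarrow> real \<Rightarrow> real set"
  proof -
    have "ts_outer_measure J T (J c d \<inter> T) \<le>
        (\<Sum>i. ennreal ((if i = 0 then d else c) - (if i = (0::nat) then c else c)))"
      using cd by (intro ts_outer_measure_le) (auto split: if_splits)
    also have "\<dots> = d - c" by (subst suminf_finite[where N = "{0}"]) auto
    finally show ?thesis .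
  qed
  have lo: "ennreal (d - c) \<le> (\<Sum>i. ennreal (v i - u i))"
    if uv: "\<And>i::nat. u i \<le> v i" and I: "I \<in> sets lborel" "emeasure lborel I = ennreal (d - c)"
      and B: "\<And>i. B i \<in> sets lborel" "\<And>i. emeasure lborel (B i) = ennreal (v i - u i)"
      and cov: "I \<subseteq> (\<Union>i. B i)" for u v :: "nat \<Rightarrow> real" and I :: "real set" and B
  proof -
    have "ennreal (d - c) \<le> emeasure lborel (\<Union>i. B i)"
      unfolding I(2)[symmetric] using B cov by (intro emeasure_mono) auto
    also have "\<dots> \<le> (\<Sum>i. emeasure lborel (B i))"
      using B by (intro emeasure_subadditive_countably) auto
    finally show ?thesis using B by simp
  qed
  have "ennreal (d - c) \<le> ts_outer_measure (\<lambda>c d. {c..<d}) T ({c..<d} \<inter> T)"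
    unfolding ts_outer_measure_def
  proof (safe intro!: Inf_greatest)
    fix u v :: "nat \<Rightarrow> real"
    assume uv: "\<forall>i. u i \<in> T \<and> v i \<in> T \<and> u i \<le> v i" and cov: "{c..<d} \<inter> T \<subseteq> (\<Union>i. {u i..<v i})"
    have "{c..<d} \<subseteq> (\<Union>i. {u i..<v i})"
    proof
      fix x assume x: "x \<in> {c..<d}"
      have "compact ({c..x} \<inter> T)" "{c..x} \<inter> T \<noteq> {}" using T cd x by auto
      from compact_attains_sup[OF this] obtain s where
        s: "s \<in> {c..x} \<inter> T" "\<And>y. y \<in> {c..x} \<inter> T \<Longrightarrow> y \<le> s" by blast
      have "s \<in> {c..<d} \<inter> T" using s(1) x by simp
      then obtain i where i: "s \<in> {u i..<v i}" using cov by blast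
      have "x < v i" using s(2)[of "v i"] i s(1) spec[OF uv, of i] by (cases "v i \<le> x") simp_all
      then show "x \<in> (\<Union>i. {u i..<v i})" using i s(1) by force
    qed
    then show "ennreal (d - c) \<le> (\<Sum>i. ennreal (v i - u i))"
      using uv cd by (intro lo[where I = "{c..<d}" and B = "\<lambda>i. {u i..<v i}"]) auto
  qed
  then show "ts_outer_measure (\<lambda>c d. {c..<d}) T ({c..<d} \<inter> T) = d - c"
    using up[of "\<lambda>c d. {c..<d}"] by (rule antisym[rotated])
  have "ennreal (d - c) \<le> ts_outer_measure (\<lambda>c d. {c<..d}) T ({c<..d} \<inter> T)"
    unfolding ts_outer_measure_def
  proof (safe intro!: Inf_greatest)
    fix u v :: "nat \<Rightarrow> real"
    assume uv: "\<forall>i. u i \<in> T \<and> v i \<in> T \<and> u i \<le> v i" and cov: "{c<..d} \<inter> T \<subseteq> (\<Union>i. {u i<..v i})"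
    have "{c<..d} \<subseteq> (\<Union>i. {u i<..v i})"
    proof
      fix x assume x: "x \<in> {c<..d}"
      have "compact ({x..d} \<inter> T)" "{x..d} \<inter> T \<noteq> {}" using T cd x by auto
      from compact_attains_inf[OF this] obtain s where
        s: "s \<in> {x..d} \<inter> T" "\<And>y. y \<in> {x..d} \<inter> T \<Longrightarrow> s \<le> y" by blast
      have "s \<in> {c<..d} \<inter> T" using s(1) x by simp
      then obtain i where i: "s \<in> {u i<..v i}" using cov by blast
      have "u i < x" using s(2)[of "u i"] i s(1) spec[OF uv, of i] by (cases "x \<le> u i") simp_all
      then show "x \<in> (\<Union>i. {u i<..v i})" using i s(1) by force
    qed
    then show "ennreal (d - c) \<le> (\<Sum>i. ennreal (v i - u i))"
      using uv cd by (intro lo[where I = "{c<..d}" and B = "\<lambda>i. {u i<..v i}"]) auto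
  qed
  then show "ts_outer_measure (\<lambda>c d. {c<..d}) T ({c<..d} \<inter> T) = d - c"
    using up[of "\<lambda>c d. {c<..d}"] by (rule antisym[rotated])
qed

lemma ts_halfline_measurable:
  assumes x: "x \<in> T"
  shows "{..<x} \<inter> T \<in> lambda_system T (Pow T) (ts_outer_measure (\<lambda>c d. {c..<d}) T)" (is ?A)
    and "{..x} \<inter> T \<in> lambda_system T (Pow T) (ts_outer_measure (\<lambda>c d. {c<..d}) T)" (is ?B)
proof -
  have *: "H \<inter> T \<in> lambda_system T (Pow T) (ts_outer_measure J T)"
    if J0: "\<And>c. J c c = {}"
      and J1: "\<And>c d. c \<le> d \<Longrightarrow> J c d \<inter> H = J (min c x) (min d x)"
      and J2: "\<And>c d. c \<le> d \<Longrightarrow> J c d - H = J (max c x) (max d x)" 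
    for J :: "real \<Rightarrow> real \<Rightarrow> real set" and H
  proof -
    let ?O = "ts_outer_measure J T"
    have oms: "outer_measure_space (Pow T) ?O"
      using x J0 by (intro ts_outer_measure_space) auto
    have "?O (X \<inter> H) + ?O (X - H) = ?O X" if X: "X \<subseteq> T" for X
    proof (rule antisym)
      show "?O (X \<inter> H) + ?O (X - H) \<le> ?O X"
        unfolding ts_outer_measure_def[of J T X]
      proof (safe intro!: Inf_greatest)
        fix u v :: "nat \<Rightarrow> real"
        assume uv: "\<forall>i. u i \<in> T \<and> v i \<in> T \<and> u i \<le> v i" and cov: "X \<subseteq> (\<Union>i. J (u i) (v i))"
        have 1: "X \<inter> H \<subseteq> (\<Union>i. J (min (u i) x) (min (v i) x))"
        proof -
          have eq: "J (min (u i) x) (min (v i) x) = J (u i) (v i) \<inter> H" for i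
            using J1[of "u i" "v i"] uv by simp
          show ?thesis unfolding eq using cov by blast
        qed
        have 2: "X - H \<subseteq> (\<Union>i. J (max (u i) x) (max (v i) x))"
        proof -
          have eq: "J (max (u i) x) (max (v i) x) = J (u i) (v i) - H" for i
            using J2[of "u i" "v i"] uv by simp
          show ?thesis unfolding eq using cov by blast
        qed
        have "?O (X \<inter> H) + ?O (X - H) \<le> (\<Sum>i. ennreal (min (v i) x - min (u i) x))
                + (\<Sum>i. ennreal (max (v i) x - max (u i) x))"
        proof (intro add_mono ts_outer_measure_le 1 2)
          show "min (u i) x \<in> T \<and> min (v i) x \<in> T \<and> min (u i) x \<le> min (v i) x"
            "max (u i) x \<in> T \<and> max (v i) x \<in> T \<and> max (u i) x \<le> max (v i) x" for i
            using spec[OF uv, of i] x by (auto simp: min_def max_def)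
        qed
        also have "\<dots> = (\<Sum>i. ennreal (min (v i) x - min (u i) x) + ennreal (max (v i) x - max (u i) x))"
          by (rule suminf_add) auto
        also have "\<dots> = (\<Sum>i. ennreal (v i - u i))"
        proof (rule suminf_cong)
          fix i show "ennreal (min (v i) x - min (u i) x) + ennreal (max (v i) x - max (u i) x) = ennreal (v i - u i)"
            using spec[OF uv, of i]
              by (auto simp: min_def max_def ennreal_plus[symmetric] simp del: ennreal_plus)
        qed
        finally show "?O (X \<inter> H) + ?O (X - H) \<le> (\<Sum>i. ennreal (v i - u i))" .
      qed
      let ?B = "binaryset (X \<inter> H) (X - H)"
      have r: "range ?B \<subseteq> Pow T" "(\<Union>n. ?B n) = X"
        using X by (auto simp: range_binaryset_eq UN_binaryset_eq)
      have "?O (\<Union>n. ?B n) \<le> (\<Sum>n. ?O (?B n))" by (rule ts_outer_measure_subadditive)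
      moreover have "(\<Sum>n. ?O (?B n)) = ?O (X \<inter> H) + ?O (X - H)"
        using oms by (intro suminf_binaryset_eq) (simp add: outer_measure_space_def positive_def)
      ultimately show "?O X \<le> ?O (X \<inter> H) + ?O (X - H)" using r by metis
    qed
    moreover have "X \<inter> (H \<inter> T) = X \<inter> H" "X - (H \<inter> T) = X - H" if "X \<subseteq> T" for X
      using that by auto
    ultimately show ?thesis by (auto simp: algebra.lambda_system_eq[OF algebra_Pow])
  qed
  show ?A by (rule *) (auto simp: min_def max_def split: if_splits)
  show ?B by (rule *) (auto simp: min_def max_def split: if_splits)
qed
lemma
  assumes T: "time_scale T" and cd: "c \<in> T" "d \<in> T" "c \<le> d"
  shows delta_interval_measurable: "{c..<d} \<inter> T \<in> sets (delta_measure T)"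
    and emeasure_delta_interval: "emeasure (delta_measure T) ({c..<d} \<inter> T) = d - c"
    and nabla_interval_measurable: "{c<..d} \<inter> T \<in> sets (nabla_measure T)"
    and emeasure_nabla_interval: "emeasure (nabla_measure T) ({c<..d} \<inter> T) = d - c"
proof -
  have ne: "T \<noteq> {}" and cl: "closed T" using T by (auto simp: time_scale_def)
  have L: "sets (delta_measure T) = lambda_system T (Pow T) (ts_outer_measure (\<lambda>c d. {c..<d}) T)"
    "sets (nabla_measure T) = lambda_system T (Pow T) (ts_outer_measure (\<lambda>c d. {c<..d}) T)"
    unfolding delta_measure_def nabla_measure_def by (rule sets_ts_measure[OF ne]; simp)+
  have 1: "{c..<d} \<inter> T = ({..<d} \<inter> T) - ({..<c} \<inter> T)" and 2: "{c<..d} \<inter> T = ({..d} \<inter> T) - ({..c} \<inter> T)"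
    by auto
  show *: "{c..<d} \<inter> T \<in> sets (delta_measure T)"
    unfolding 1 using ts_halfline_measurable(1) cd by (intro sets.Diff) (simp_all add: L)
  show **: "{c<..d} \<inter> T \<in> sets (nabla_measure T)"
    unfolding 2 using ts_halfline_measurable(2) cd by (intro sets.Diff) (simp_all add: L)
  show "emeasure (delta_measure T) ({c..<d} \<inter> T) = d - c"
    using * ts_outer_measure_interval(1)[OF cl cd] emeasure_ts_measure[OF ne, of "\<lambda>c d. {c..<d}"]
    by (simp add: delta_measure_def[abs_def] L(1)[unfolded delta_measure_def])
  show "emeasure (nabla_measure T) ({c<..d} \<inter> T) = d - c"
    using ** ts_outer_measure_interval(2)[OF cl cd] emeasure_ts_measure[OF ne, of "\<lambda>c d. {c<..d}"]
    by (simp add: nabla_measure_def[abs_def] L(2)[unfolded nabla_measure_def])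
qed

end

(* Kantorovich's ratio controls the defect in the weighted arithmetic-geometric mean inequality:
   x/p + y/q <= kappa(x/y)^gamma x^(1/p) y^(1/q). Normalize x = |f|^p / A and y = |g|^q / B,
   where A and B are the means of |f|^p and |g|^q with respect to the positive functional
   h -> I(|w| h), which sends 1 to 1. Then x/y lies in [1/H, H] for H = (M/m)^p (N/n)^q,
   so kappa(x/y) <= kappa(H), and applying the functional turns the left-hand side into
   1/p + 1/q = 1. *)
theory Submission
  imports Defs
begin

lemma kantorovich_ratio_inverse:
  assumes "h > 0"
  shows "kantorovich_ratio (inverse h) = kantorovich_ratio h"
  using assms by (simp add: kantorovich_ratio_def field_simps power2_eq_square)

text \<open>After clearing denominators the difference of the two sides is
  \<open>(h - u) * (h * u - 1)\<close>. The ratio decreases on (0,1] and increases on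
  [1,\<infinity>), so \<open>u\<close> must be bounded on both sides: the last two assumptions place
  it in [1/h, h].\<close>

lemma kantorovich_ratio_mono:
  assumes "u > 0" "u \<le> h" "1 \<le> h * u"
  shows "kantorovich_ratio u \<le> kantorovich_ratio h"
proof -
  have h: "h > 0" using assms by linarith
  have "0 \<le> (h - u) * (h * u - 1)" using assms by simp
  then have "(u + 1)\<^sup>2 * h \<le> (h + 1)\<^sup>2 * u"
    by (simp add: power2_eq_square algebra_simps)
  then show ?thesis
    using assms(1) h by (simp add: kantorovich_ratio_def divide_simps mult.commute)
qed

text \<open>Dividing by \<open>y\<close> and setting r = z/y gives Bernoulli's inequality 1 + c (r -
  1) \<le> r^c. It follows from Young's inequality with weights \<open>1 / c\<close> and
  \<open>1 - 1 / c\<close>, because \<open>z\<close> is the corresponding weighted geometric mean of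
  the right-hand side and \<open>y\<close>.\<close>

lemma Bernoulli_powr_two_variables:
  fixes c y z :: real
  assumes "c \<ge> 1" "y > 0" "z > 0"
  shows "c * z + (1 - c) * y \<le> z powr c * y powr (1 - c)"
proof -
  define v where "v = z powr c * y powr (1 - c)"
  have v: "v > 0" using assms by (simp add: v_def)
  have "v powr (1 / c) = z * y powr ((1 - c) / c)"
    using assms by (simp add: v_def powr_mult powr_powr)
  then have "z = v powr (1 / c) * y powr (1 - 1 / c)"
    using assms by (simp add: powr_add[symmetric] diff_divide_distrib)
  also have "\<dots> \<le> 1 / c * v + (1 - 1 / c) * y"
    using assms v by (intro Youngs_inequality_0) auto
  finally have "c * z \<le> c * (1 / c * v + (1 - 1 / c) * y)"
    using assms by (intro mult_left_mono) auto
  also have "\<dots> = v + (c - 1) * y" using assms by (simp add: field_simps)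
  finally show ?thesis unfolding v_def by (simp add: algebra_simps)
qed

text \<open>With \<open>z = (x + y) / 2\<close> and \<open>c = 2 * u\<close>, the right-hand side is \<open>z\<^sup>c y\<^sup>1\<^sup>-\<^sup>c\<close>
  and the left-hand side is \<open>c z + (1 - c) y\<close>.\<close>
lemma reverse_Young_Kantorovich_ge_half:
  assumes "1 / 2 \<le> u" "x > 0" "y > 0"
  shows "u * x + (1 - u) * y \<le> kantorovich_ratio (x / y) powr u * (x powr u * y powr (1 - u))"
proof -
  define z where "z = (x + y) / 2"
  have z: "z > 0" using assms by (simp add: z_def)
  \<comment> \<open>The Kantorovich ratio of \<open>x / y\<close> is the square of the arithmetic
    mean over the geometric mean of \<open>x\<close> and \<open>y\<close>; this is why its power
    \<open>u\<close> produces \<open>z powr (2 * u)\<close>.\<close>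
  have "kantorovich_ratio (x / y) = z\<^sup>2 / (x * y)"
    using assms by (simp add: kantorovich_ratio_def z_def field_simps power2_eq_square)
  also have "\<dots> = z powr 2 / (x * y)" using z by simp
  finally have "kantorovich_ratio (x / y) powr u = z powr (2 * u) / (x powr u * y powr u)"
    using assms by (simp add: powr_divide powr_mult powr_powr)
  then have "kantorovich_ratio (x / y) powr u * (x powr u * y powr (1 - u))
      = z powr (2 * u) * (y powr (1 - u) / y powr u)"
    using assms by simp
  also have "\<dots> = z powr (2 * u) * y powr (1 - 2 * u)"
    by (simp add: powr_diff[symmetric])
  finally have "kantorovich_ratio (x / y) powr u * (x powr u * y powr (1 - u))
      = z powr (2 * u) * y powr (1 - 2 * u)" .
  moreover have "u * x + (1 - u) * y = 2 * u * z + (1 - 2 * u) * y"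
    by (simp add: z_def field_simps)
  \<comment> \<open>The assumption \<open>1 / 2 \<le> u\<close> is exactly the condition
    \<open>c \<ge> 1\<close> for \<open>c = 2 * u\<close>.\<close>
  ultimately show ?thesis
    using Bernoulli_powr_two_variables[of "2 * u" y z] assms z by simp
qed

text \<open>The larger of the two weights is at least 1/2. If it is \<open>v\<close>, the roles of
  \<open>x\<close> and \<open>y\<close> are exchanged, which inverts their quotient but leaves its
  Kantorovich ratio unchanged.\<close>

lemma reverse_Young_Kantorovich:
  assumes "u + v = 1" "x > 0" "y > 0"
  shows "u * x + v * y \<le> kantorovich_ratio (x / y) powr max u v * (x powr u * y powr v)"
proof (cases "v \<le> u")
  case True
  have v: "1 - u = v" using assms(1) by simp
  show ?thesis
    using reverse_Young_Kantorovich_ge_half[of u x y, unfolded v] assms True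
    by (simp add: max_def)
next
  case False
  have u: "1 - v = u" using assms(1) by simp
  have "kantorovich_ratio (y / x) = kantorovich_ratio (x / y)"
    using kantorovich_ratio_inverse[of "x / y"] assms by simp
  then show ?thesis
    using reverse_Young_Kantorovich_ge_half[of v y x, unfolded u] assms False
    by (simp add: max_def ac_simps)
qed

lemma kernel_integrable_cmult:
  assumes "kernel_integrable T a K h t"
  shows "kernel_integrable T a K (\<lambda>s. c * h s) t"
  using assms
  by (simp add: kernel_integrable_def diamond_integrable_def delta_integrable_def
      nabla_integrable_def mult.left_commute[of _ c])

lemma kernel_integrable_add:
  assumes "kernel_integrable T a K h t" "kernel_integrable T a K k t"
  shows "kernel_integrable T a K (\<lambda>s. h s + k s) t"
  using assms
  by (simp add: kernel_integrable_def diamond_integrable_def delta_integrable_def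
      nabla_integrable_def distrib_left set_integral_add)

text \<open>A non-integrable function has integral 0 by default, and scaling preserves 0, so the
  identity holds whether or not the integrals converge.\<close>

lemma kernel_operator_cmult:
  "kernel_operator T a \<alpha> K (\<lambda>s. c * h s) t = c * kernel_operator T a \<alpha> K h t"
  by (simp add: kernel_operator_def diamond_integral_def delta_integral_def
      nabla_integral_def mult.left_commute[of _ c] distrib_left)

lemma kernel_operator_add:
  assumes "kernel_integrable T a K h t" "kernel_integrable T a K k t"
  shows "kernel_operator T a \<alpha> K (\<lambda>s. h s + k s) t
    = kernel_operator T a \<alpha> K h t + kernel_operator T a \<alpha> K k t"
  using assms
  by (simp add: kernel_integrable_def diamond_integrable_def delta_integrable_def
      nabla_integrable_def kernel_operator_def diamond_integral_def delta_integral_def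
      nabla_integral_def distrib_left set_integral_add)

text \<open>The operator is a convex combination of two integrals against a nonnegative kernel.
  Their domains, half-open at opposite ends, both lie in \<open>{a..t} \<inter> T\<close>.\<close>

lemma kernel_operator_mono:
  assumes "0 \<le> \<alpha>" "\<alpha> \<le> 1"
    and "kernel_integrable T a K h t" "kernel_integrable T a K k t"
    and "\<And>s. s \<in> {a..t} \<inter> T \<Longrightarrow> 0 \<le> K t s"
    and "\<And>s. s \<in> {a..t} \<inter> T \<Longrightarrow> h s \<le> k s"
  shows "kernel_operator T a \<alpha> K h t \<le> kernel_operator T a \<alpha> K k t"
  using assms
  unfolding kernel_integrable_def diamond_integrable_def delta_integrable_def
    nabla_integrable_def kernel_operator_def diamond_integral_def delta_integral_def
    nabla_integral_def
  by (intro add_mono mult_left_mono set_integral_mono) auto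

theorem theorem3p13:
  fixes T :: "real set" and a b t \<alpha> p q m M n N :: real
    and w f g :: "real \<Rightarrow> real" and K :: "real \<Rightarrow> real \<Rightarrow> real"
  assumes "time_scale T"
    and "a \<in> T" and "b \<in> T" and "a < b"
    and "t \<in> {a<..b} \<inter> T"
    and "0 \<le> \<alpha>" and "\<alpha> \<le> 1"
    and "continuous_on ({a..b} \<inter> T) w"
    and "continuous_on ({a..b} \<inter> T) f"
    and "continuous_on ({a..b} \<inter> T) g"
    and "diamond_integrable T a b w"
    and "diamond_integrable T a b f"
    and "diamond_integrable T a b g"
    and "\<And>x s. x \<in> {a..b} \<inter> T \<Longrightarrow> s \<in> {a..b} \<inter> T \<Longrightarrow> 0 \<le> K x s"
    and "kernel_integrable T a K (\<lambda>s. \<bar>w s\<bar>) t"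
    and "kernel_integrable T a K (\<lambda>s. \<bar>w s\<bar> * \<bar>f s\<bar> powr p) t"
    and "kernel_integrable T a K (\<lambda>s. \<bar>w s\<bar> * \<bar>g s\<bar> powr q) t"
    and "kernel_integrable T a K (\<lambda>s. \<bar>w s\<bar> * \<bar>f s\<bar> * \<bar>g s\<bar>) t"
    and "p > 1" and "q > 1" and "1 / p + 1 / q = 1"
    and "kernel_operator T a \<alpha> K (\<lambda>s. \<bar>w s\<bar>) t = 1"
    and "0 < m" and "0 < n"
    and "\<And>s. s \<in> {a..t} \<inter> T \<Longrightarrow> m \<le> \<bar>f s\<bar> \<and> \<bar>f s\<bar> \<le> M"
    and "\<And>s. s \<in> {a..t} \<inter> T \<Longrightarrow> n \<le> \<bar>g s\<bar> \<and> \<bar>g s\<bar> \<le> N"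
  shows "(kernel_operator T a \<alpha> K (\<lambda>s. \<bar>w s\<bar> * \<bar>f s\<bar> powr p) t) powr (1 / p)
           * (kernel_operator T a \<alpha> K (\<lambda>s. \<bar>w s\<bar> * \<bar>g s\<bar> powr q) t) powr (1 / q)
         \<le> kantorovich_ratio ((M / m) powr p * (N / n) powr q) powr max (1 / p) (1 / q)
           * kernel_operator T a \<alpha> K (\<lambda>s. \<bar>w s\<bar> * \<bar>f s\<bar> * \<bar>g s\<bar>) t"
proof -
  define I where "I h = kernel_operator T a \<alpha> K h t" for h
  define A where "A = I (\<lambda>s. \<bar>w s\<bar> * \<bar>f s\<bar> powr p)"
  define B where "B = I (\<lambda>s. \<bar>w s\<bar> * \<bar>g s\<bar> powr q)"
  define D where "D = A powr (1 / p) * B powr (1 / q)"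
  define H where "H = (M / m) powr p * (N / n) powr q"
  define C where "C = kantorovich_ratio H powr max (1 / p) (1 / q)"
  note Int = assms(15-18)
  note pq = assms(19-21)
  note mn = assms(23,24)
  note fb = assms(25) and gb = assms(26)
  have K: "0 \<le> K t s" if "s \<in> {a..t} \<inter> T" for s
    using assms(5,14) that by auto
  have mono: "I h \<le> I k"
    if "kernel_integrable T a K h t" "kernel_integrable T a K k t"
      "\<And>s. s \<in> {a..t} \<inter> T \<Longrightarrow> h s \<le> k s" for h k
    unfolding I_def by (rule kernel_operator_mono[OF assms(6,7) that(1,2) K that(3)])
  have I_cmult: "I (\<lambda>s. c * h s) = c * I h" for c h
    unfolding I_def by (rule kernel_operator_cmult)
  have I1: "I (\<lambda>s. \<bar>w s\<bar>) = 1" unfolding I_def by (rule assms(22))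
  \<comment> \<open>By \<open>I1\<close>, the multiple \<open>c * \<bar>w s\<bar>\<close> of the
    weight has image \<open>c\<close> under \<open>I\<close>, so comparison with such multiples
    shows that \<open>I\<close> acts as a weighted mean.\<close>
  have mean_bounds: "c \<le> I (\<lambda>s. \<bar>w s\<bar> * h s) \<and> I (\<lambda>s. \<bar>w s\<bar> * h s) \<le> d"
    if "kernel_integrable T a K (\<lambda>s. \<bar>w s\<bar> * h s) t"
      "\<And>s. s \<in> {a..t} \<inter> T \<Longrightarrow> c \<le> h s \<and> h s \<le> d" for c d h
  proof
    have "I (\<lambda>s. c * \<bar>w s\<bar>) \<le> I (\<lambda>s. \<bar>w s\<bar> * h s)"
      using that(2)
      by (intro mono kernel_integrable_cmult Int(1) that(1))
        (simp add: mult.commute[of c] mult_left_mono)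
    then show "c \<le> I (\<lambda>s. \<bar>w s\<bar> * h s)" by (simp add: I_cmult I1)
    have "I (\<lambda>s. \<bar>w s\<bar> * h s) \<le> I (\<lambda>s. d * \<bar>w s\<bar>)"
      using that(2)
      by (intro mono kernel_integrable_cmult Int(1) that(1))
        (simp add: mult.commute[of d] mult_left_mono)
    then show "I (\<lambda>s. \<bar>w s\<bar> * h s) \<le> d" by (simp add: I_cmult I1)
  qed
  \<comment> \<open>Evaluating the bounds at the point \<open>a\<close> makes the upper constants
    positive.\<close>
  have "a \<in> {a..t} \<inter> T" using assms(2,5) by auto
  then have MN: "M > 0" "N > 0" using fb[of a] gb[of a] mn by auto
  have F: "m powr p \<le> \<bar>f s\<bar> powr p \<and> \<bar>f s\<bar> powr p \<le> M powr p" if "s \<in> {a..t} \<inter> T" for s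
    using fb[OF that] mn pq by (auto intro!: powr_mono2)
  have G: "n powr q \<le> \<bar>g s\<bar> powr q \<and> \<bar>g s\<bar> powr q \<le> N powr q" if "s \<in> {a..t} \<inter> T" for s
    using gb[OF that] mn pq by (auto intro!: powr_mono2)
  have A: "m powr p \<le> A" "A \<le> M powr p"
    using mean_bounds[OF Int(2) F] by (simp_all add: A_def)
  have B: "n powr q \<le> B" "B \<le> N powr q"
    using mean_bounds[OF Int(3) G] by (simp_all add: B_def)
  have pos: "0 < m powr p" "0 < n powr q" "0 < M powr p" "0 < N powr q"
    using mn MN by simp_all
  have AB: "A > 0" "B > 0" using A B pos by linarith+
  have D: "D > 0" using AB by (simp add: D_def)
  have H: "H = (M powr p * N powr q) / (m powr p * n powr q)"
    using mn MN by (simp add: H_def powr_divide)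
  have pointwise: "1 / p / A * \<bar>f s\<bar> powr p + 1 / q / B * \<bar>g s\<bar> powr q \<le> C / D * (\<bar>f s\<bar> * \<bar>g s\<bar>)"
    if s: "s \<in> {a..t} \<inter> T" for s
  proof -
    define x where "x = \<bar>f s\<bar> powr p / A"
    define y where "y = \<bar>g s\<bar> powr q / B"
    have f0: "\<bar>f s\<bar> > 0" and g0: "\<bar>g s\<bar> > 0" using fb[OF s] gb[OF s] mn by linarith+
    then have xy: "x > 0" "y > 0" using AB by (simp_all add: x_def y_def)
    \<comment> \<open>The mean \<open>A\<close> lies in the same interval as the values
      \<open>\<bar>f s\<bar> powr p\<close>, so the extreme quotients come from opposite end
      points.\<close>
    have xb: "m powr p / M powr p \<le> x" "x \<le> M powr p / m powr p"
      unfolding x_def using F[OF s] A AB pos by (intro frac_le; linarith)+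
    have yb: "n powr q / N powr q \<le> y" "y \<le> N powr q / n powr q"
      unfolding y_def using G[OF s] B AB pos by (intro frac_le; linarith)+
    have up: "x / y \<le> H"
    proof -
      have "x / y \<le> (M powr p / m powr p) / (n powr q / N powr q)"
        using xb yb xy pos by (intro frac_le) auto
      then show ?thesis by (simp add: H mult.commute)
    qed
    \<comment> \<open>This is the lower bound 1/H for \<open>x / y\<close>, in the product form that
      \<open>kantorovich_ratio_mono\<close> expects.\<close>
    have lo: "1 \<le> H * (x / y)"
    proof -
      have "(m powr p / M powr p) / (N powr q / n powr q) \<le> x / y"
        using xb yb xy pos by (intro frac_le) auto
      then have "H * ((m powr p / M powr p) / (N powr q / n powr q)) \<le> H * (x / y)"
        by (intro mult_left_mono) (auto simp: H)
      then show ?thesis using pos by (simp add: H)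
    qed
    have "1 / p * x + 1 / q * y
        \<le> kantorovich_ratio (x / y) powr max (1 / p) (1 / q) * (x powr (1 / p) * y powr (1 / q))"
      by (rule reverse_Young_Kantorovich[OF pq(3) xy])
    also have "\<dots> \<le> C * (x powr (1 / p) * y powr (1 / q))"
      unfolding C_def using xy up lo pq
      by (intro mult_right_mono powr_mono2 kantorovich_ratio_mono)
        (auto simp: kantorovich_ratio_def le_max_iff_disj)
    \<comment> \<open>The outer exponents undo the powers \<open>p\<close> and \<open>q\<close>, and
      the normalizing factors \<open>A\<close> and \<open>B\<close> combine to
      \<open>D\<close>.\<close>
    also have "x powr (1 / p) * y powr (1 / q) = \<bar>f s\<bar> * \<bar>g s\<bar> / D"
      using f0 g0 AB pq by (simp add: x_def y_def D_def powr_divide powr_powr)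
    finally show ?thesis by (simp add: x_def y_def mult.commute)
  qed
  have intA: "kernel_integrable T a K (\<lambda>s. 1 / p / A * (\<bar>w s\<bar> * \<bar>f s\<bar> powr p)) t"
    and intB: "kernel_integrable T a K (\<lambda>s. 1 / q / B * (\<bar>w s\<bar> * \<bar>g s\<bar> powr q)) t"
    and intC: "kernel_integrable T a K (\<lambda>s. C / D * (\<bar>w s\<bar> * \<bar>f s\<bar> * \<bar>g s\<bar>)) t"
    by (rule kernel_integrable_cmult, rule Int)+
  \<comment> \<open>Normalization makes the mean of the weighted sum of \<open>x\<close> and
    \<open>y\<close> equal to 1/p + 1/q; bounding it by the mean of the pointwise right-hand side
    leaves only a multiplication by \<open>D\<close>.\<close>
  have "1 = 1 / p / A * A + 1 / q / B * B" using AB pq by simp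
  also have "\<dots> = I (\<lambda>s. 1 / p / A * (\<bar>w s\<bar> * \<bar>f s\<bar> powr p) + 1 / q / B * (\<bar>w s\<bar> * \<bar>g s\<bar> powr q))"
    using kernel_operator_add[OF intA intB, of \<alpha>] unfolding I_def[symmetric] I_cmult
    by (simp add: A_def B_def)
  also have "\<dots> \<le> I (\<lambda>s. C / D * (\<bar>w s\<bar> * \<bar>f s\<bar> * \<bar>g s\<bar>))"
  proof (rule mono[OF kernel_integrable_add[OF intA intB] intC])
    fix s assume "s \<in> {a..t} \<inter> T"
    from mult_left_mono[OF pointwise[OF this] abs_ge_zero[of "w s"]]
    show "1 / p / A * (\<bar>w s\<bar> * \<bar>f s\<bar> powr p) + 1 / q / B * (\<bar>w s\<bar> * \<bar>g s\<bar> powr q)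
        \<le> C / D * (\<bar>w s\<bar> * \<bar>f s\<bar> * \<bar>g s\<bar>)"
      by (simp add: algebra_simps)
  qed
  also have "\<dots> = C * I (\<lambda>s. \<bar>w s\<bar> * \<bar>f s\<bar> * \<bar>g s\<bar>) / D"
    unfolding I_cmult by simp
  finally have "D \<le> C * I (\<lambda>s. \<bar>w s\<bar> * \<bar>f s\<bar> * \<bar>g s\<bar>)"
    using D by (simp add: le_divide_eq)
  then show ?thesis
    by (simp add: D_def C_def H_def A_def B_def I_def)
qed

end
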